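(* Let $X$ be a Banach space, $S \subseteq X$ and $T: S \to X$. The following are equivalent: (a) $T$ is super strongly nonexpansive; (b) there exists a function $\chi:(0,\infty) \to (0,\infty)$ such that, for any $\varepsilon > 0$ and $x,y \in S$ with $\|x-y\|^2 - \|Tx-Ty\|^2 < \chi(\varepsilon)$, we have that $\|(x-y) - (Tx-Ty)\| < \varepsilon$.
   Context: Let $X$ be a Banach space, $S\subseteq X$ and $T:S\to X$. $T$ is nonexpansive if $\|Tx-Ty\|\le\|x-y\|$ for all $x,y\in S$. $T$ is super strongly nonexpansive if it is nonexpansive and, for all sequences $(x_n),(y_n)\subseteq S$ such that $\lim_{n\to\infty}(\|x_n-y_n\|^2-\|Tx_n-Ty_n\|^2)=0$, we have $\lim_{n\to\infty}((x_n-y_n)-(Tx_n-Ty_n))=0$. *)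

theory Defs
  imports "HOL-Analysis.Analysis"
begin

text \<open>A map from a subset \<open>S\<close> of the space is a total function of which only the values on \<open>S\<close> matter.\<close>

definition nonexpansive_on :: "'a::real_normed_vector set \<Rightarrow> ('a \<Rightarrow> 'a) \<Rightarrow> bool" where
  "nonexpansive_on S T \<longleftrightarrow> (\<forall>x\<in>S. \<forall>y\<in>S. norm (T x - T y) \<le> norm (x - y))"

definition super_strongly_nonexpansive_on ::
    "'a::real_normed_vector set \<Rightarrow> ('a \<Rightarrow> 'a) \<Rightarrow> bool" where
  "super_strongly_nonexpansive_on S T \<longleftrightarrow>
     nonexpansive_on S T \<and>
     (\<forall>x y :: nat \<Rightarrow> 'a.
        (\<forall>n. x n \<in> S) \<longrightarrow> (\<forall>n. y n \<in> S) \<longrightarrow>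
        (\<lambda>n. (norm (x n - y n))\<^sup>2 - (norm (T (x n) - T (y n)))\<^sup>2) \<longlonglongrightarrow> 0 \<longrightarrow>
        (\<lambda>n. (x n - y n) - (T (x n) - T (y n))) \<longlonglongrightarrow> 0)"

end

theory Submission
  imports Defs
begin

lemma super_strongly_nonexpansive_on_modulus:
  fixes S :: "'a::real_normed_vector set"
  assumes ssne: "super_strongly_nonexpansive_on S T" and "\<epsilon> > 0"
  shows "\<exists>\<delta>>0. \<forall>x\<in>S. \<forall>y\<in>S.
    (norm (x - y))\<^sup>2 - (norm (T x - T y))\<^sup>2 < \<delta> \<longrightarrow> norm ((x - y) - (T x - T y)) < \<epsilon>"
proof (rule ccontr)
  assume no_modulus: "\<not> ?thesis"
  have "\<exists>x y. x \<in> S \<and> y \<in> S \<and>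
      (norm (x - y))\<^sup>2 - (norm (T x - T y))\<^sup>2 < inverse (real (Suc n)) \<and>
      \<epsilon> \<le> norm ((x - y) - (T x - T y))" for n
  proof -
    have "0 < inverse (real (Suc n))" by simp
    with no_modulus show ?thesis by (meson not_less)
  qed
  then obtain x y where S: "\<And>n. x n \<in> S" "\<And>n. y n \<in> S"
    and less: "\<And>n. (norm (x n - y n))\<^sup>2 - (norm (T (x n) - T (y n)))\<^sup>2 < inverse (real (Suc n))"
    and far: "\<And>n. \<epsilon> \<le> norm ((x n - y n) - (T (x n) - T (y n)))"
    by metis
  \<comment> \<open>Nonexpansiveness supplies the lower half of the sandwich; the choice of the
    pairs bounds the differences only from above.\<close>
  have nonneg: "0 \<le> (norm (x n - y n))\<^sup>2 - (norm (T (x n) - T (y n)))\<^sup>2" for n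
    using ssne S
    by (simp add: super_strongly_nonexpansive_on_def nonexpansive_on_def power_mono)
  have "(\<lambda>n. (norm (x n - y n))\<^sup>2 - (norm (T (x n) - T (y n)))\<^sup>2) \<longlonglongrightarrow> 0"
    by (rule tendsto_sandwich[OF _ _ tendsto_const LIMSEQ_inverse_real_of_nat])
      (intro always_eventually allI nonneg less_imp_le[OF less])+
  then have "(\<lambda>n. (x n - y n) - (T (x n) - T (y n))) \<longlonglongrightarrow> 0"
    using ssne S by (simp add: super_strongly_nonexpansive_on_def)
  then obtain n where "norm ((x n - y n) - (T (x n) - T (y n))) < \<epsilon>"
    using LIMSEQ_D[OF _ \<open>\<epsilon> > 0\<close>] by fastforce
  with far[of n] show False by simp
qed

text \<open>Nonexpansiveness can be extracted from \<open>modulus\<close> because its premise has no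
  absolute value: a negative difference of squares satisfies it too.\<close>

lemma super_strongly_nonexpansive_onI:
  fixes S :: "'a::real_normed_vector set"
  assumes pos: "\<And>\<epsilon>::real. \<epsilon> > 0 \<Longrightarrow> chi \<epsilon> > (0::real)"
    and modulus: "\<And>\<epsilon> x y. \<lbrakk>\<epsilon> > 0; x \<in> S; y \<in> S;
      (norm (x - y))\<^sup>2 - (norm (T x - T y))\<^sup>2 < chi \<epsilon>\<rbrakk> \<Longrightarrow> norm ((x - y) - (T x - T y)) < \<epsilon>"
  shows "super_strongly_nonexpansive_on S T"
  unfolding super_strongly_nonexpansive_on_def nonexpansive_on_def
proof (intro conjI ballI allI impI)
  fix x y assume xy: "x \<in> S" "y \<in> S"
  show "norm (T x - T y) \<le> norm (x - y)"
  proof (rule ccontr)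
    assume expands: "\<not> ?thesis"
    \<comment> \<open>The difference of squares is negative, hence below \<open>chi \<epsilon>\<close> for every \<open>\<epsilon>\<close>.\<close>
    then have "(norm (x - y))\<^sup>2 < (norm (T x - T y))\<^sup>2"
      by (simp add: power_strict_mono)
    then have "norm ((x - y) - (T x - T y)) < \<epsilon>" if "\<epsilon> > 0" for \<epsilon>
      using modulus[OF that xy] pos[OF that] by linarith
    \<comment> \<open>Otherwise \<epsilon> could be taken to be the norm of the difference of the
      two sides, which would then be less than itself.\<close>
    then have "x - y = T x - T y"
      by (metis less_irrefl right_minus_eq zero_less_norm_iff)
    with expands show False by simp
  qed
next
  fix x y :: "nat \<Rightarrow> 'a"
  assume S: "\<forall>n. x n \<in> S" "\<forall>n. y n \<in> S"
    and lim: "(\<lambda>n. (norm (x n - y n))\<^sup>2 - (norm (T (x n) - T (y n)))\<^sup>2) \<longlonglongrightarrow> 0"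
  show "(\<lambda>n. (x n - y n) - (T (x n) - T (y n))) \<longlonglongrightarrow> 0"
  proof (rule tendstoI)
    fix \<epsilon> :: real assume "\<epsilon> > 0"
    \<comment> \<open>The limit 0 lies strictly below \<open>chi \<epsilon>\<close>, so the terms
      eventually do as well.\<close>
    have "\<forall>\<^sub>F n in sequentially. (norm (x n - y n))\<^sup>2 - (norm (T (x n) - T (y n)))\<^sup>2 < chi \<epsilon>"
      by (rule order_tendstoD(2)[OF lim pos[OF \<open>\<epsilon> > 0\<close>]])
    then show "\<forall>\<^sub>F n in sequentially. dist ((x n - y n) - (T (x n) - T (y n))) 0 < \<epsilon>"
      by eventually_elim (use modulus[OF \<open>\<epsilon> > 0\<close>] S in \<open>simp add: dist_norm\<close>)
  qed
qed

theorem proposition2p6: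
  fixes S :: "'a::banach set" and T :: "'a \<Rightarrow> 'a"
  shows "super_strongly_nonexpansive_on S T \<longleftrightarrow>
    (\<exists>chi :: real \<Rightarrow> real.
       (\<forall>\<epsilon>>0. chi \<epsilon> > 0) \<and>
       (\<forall>\<epsilon>>0. \<forall>x\<in>S. \<forall>y\<in>S.
          (norm (x - y))\<^sup>2 - (norm (T x - T y))\<^sup>2 < chi \<epsilon> \<longrightarrow>
          norm ((x - y) - (T x - T y)) < \<epsilon>))"
    (is "_ \<longleftrightarrow> ?modulus")
proof
  assume "super_strongly_nonexpansive_on S T"
  \<comment> \<open>The axiom of choice turns one \<delta> for each positive \<epsilon> into a
    function; its values at other arguments are unconstrained.\<close>
  from super_strongly_nonexpansive_on_modulus[OF this] show ?modulus
    by metis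
next
  assume ?modulus
  then obtain chi :: "real \<Rightarrow> real" where "\<forall>\<epsilon>>0. chi \<epsilon> > 0"
    and "\<forall>\<epsilon>>0. \<forall>x\<in>S. \<forall>y\<in>S.
      (norm (x - y))\<^sup>2 - (norm (T x - T y))\<^sup>2 < chi \<epsilon> \<longrightarrow>
      norm ((x - y) - (T x - T y)) < \<epsilon>"
    by (elim exE conjE)
  then show "super_strongly_nonexpansive_on S T"
    by (intro super_strongly_nonexpansive_onI[where chi = chi]) simp_all
qed

end
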